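(* Let $L$ be a nonempty set (a language) and let $\emptyset\neq\mathcal{H}\subset\mathcal{C}_f(L)$, where $\mathcal{C}_f(L)$ is the set of all finite consequence operators on $\mathcal{P}(L)$. For each $C\in\mathcal{H}$ let $RI_C(L)$ be any general rules of inference on $L$ such that $RI_C(L)\Rightarrow C$. Then $$\bigcup\{RI_C(L)\mid C\in\mathcal{H}\}\ \Rightarrow\ \bigvee\nolimits_w\mathcal{H},$$ i.e. the operator generated by the union of these rules of inference is $\bigvee_w\mathcal{H}$, the supremum of $\mathcal{H}$.
   Context: $\mathcal{P}(L)$ is the power set of $L$ and $\mathcal{F}(X)$ is the set of all finite subsets of $X$. The language $L$ is just a nonempty set; no further structure is assumed. A general consequence operator on $\mathcal{P}(L)$ is a map $C\colon\mathcal{P}(L)\to\mathcal{P}(L)$ such that for all $X,Y\subset L$: (1) $X\subset C(X)=C(C(X))$; (2) if $X\subset Y$, then $C(X)\subset C(Y)$. It is a finite consequence operator if, in addition, $C(X)=\bigcup\{C(F)\mid F\in\mathcal{F}(X)\}$ for all $X\subset L$. Let $\mathcal{C}(L)$ and $\mathcal{C}_f(L)$ be the sets of all general, respectively finite, consequence operators, ordered by $C_1\leq C_2$ iff $C_1(X)\subset C_2(X)$ for all $X\subset L$. For $C\in\mathcal{C}(L)$ let $\mathcal{S}(C)=\{Y\subset L\mid C(Y)=Y\}$. For nonempty $\mathcal{H}\subset\mathcal{C}_f(L)$ put $\mathcal{S}'=\bigcap\{\mathcal{S}(C)\mid C\in\mathcal{H}\}$ and define $(\bigvee_w\mathcal{H})(X)=\bigcap\{Y\mid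 X\subset Y\subset L,\ Y\in\mathcal{S}'\}$ for $X\subset L$. This is the supremum of $\mathcal{H}$ in $\langle\mathcal{C}(L),\leq\rangle$. A general rules of inference on $L$ is a finite or infinite set $RI(L)$ of relations on $L$, each of which is $n$-ary for some $n\geq 1$. A deduction from $X\subset L$ using $RI(L)$ is a finite sequence $b_1,\ldots,b_m$ ($m\geq 1$) of members of $L$ such that for each $i$ at least one of the following holds: $b_i\in X$; $b_i$ is a member of some unary relation in $RI(L)$; there are $j\geq 1$, a $(j+1)$-ary relation $R\in RI(L)$ and a tuple $(a_1,\ldots,a_j,a_{j+1})\in R$ with $a_1,\ldots,a_j\in\{b_1,\ldots,b_{i-1}\}$ and $b_i=a_{j+1}$. One writes $X\vdash x$ if there is such a deduction whose last term is $x$. The notation $RI(L)\Rightarrow C$ means that $C\colon\mathcal{P}(L)\to\mathcal{P}(L)$ is the map $C(X)=\{x\in L\mid X\vdash x\}$. *)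

theory Defs
  imports "HOL-Library.FuncSet" "HOL-Algebra.Order"
begin

text \<open>Maps from the power set of L to itself are elements of the extensional function space
  \<open>Pow L \<rightarrow>\<^sub>E Pow L\<close>, so that two of them are equal iff they agree on all subsets of L.\<close>

definition conseq_ops :: "'a set \<Rightarrow> ('a set \<Rightarrow> 'a set) set" where
  "conseq_ops L = {C \<in> Pow L \<rightarrow>\<^sub>E Pow L.
     (\<forall>X\<in>Pow L. X \<subseteq> C X \<and> C X = C (C X)) \<and>
     (\<forall>X\<in>Pow L. \<forall>Y\<in>Pow L. X \<subseteq> Y \<longrightarrow> C X \<subseteq> C Y)}"

definition finite_conseq_ops :: "'a set \<Rightarrow> ('a set \<Rightarrow> 'a set) set" where
  "finite_conseq_ops L = {C \<in> conseq_ops L. \<forall>X\<in>Pow L. C X = (\<Union>F\<in>Fpow X. C F)}"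

definition conseq_order :: "'a set \<Rightarrow> ('a set \<Rightarrow> 'a set) gorder" where
  "conseq_order L =
     \<lparr>carrier = conseq_ops L, eq = (=), le = (\<lambda>C1 C2. \<forall>X\<in>Pow L. C1 X \<subseteq> C2 X)\<rparr>"

definition closed_systems :: "'a set \<Rightarrow> ('a set \<Rightarrow> 'a set) \<Rightarrow> 'a set set" where
  "closed_systems L C = {Y \<in> Pow L. C Y = Y}"

definition sup_w :: "'a set \<Rightarrow> ('a set \<Rightarrow> 'a set) set \<Rightarrow> 'a set \<Rightarrow> 'a set" where
  "sup_w L H = (\<lambda>X\<in>Pow L. \<Inter>{Y. X \<subseteq> Y \<and> Y \<subseteq> L \<and> Y \<in> (\<Inter>C\<in>H. closed_systems L C)})"

text \<open>An n-ary relation on L is a set of n-tuples, represented as lists of length n over L.\<close>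

definition nary_rel :: "'a set \<Rightarrow> nat \<Rightarrow> 'a list set \<Rightarrow> bool" where
  "nary_rel L n R \<longleftrightarrow> R \<subseteq> {t \<in> lists L. length t = n}"

definition rules_of_inference :: "'a set \<Rightarrow> 'a list set set \<Rightarrow> bool" where
  "rules_of_inference L RI \<longleftrightarrow> (\<forall>R\<in>RI. \<exists>n\<ge>1. nary_rel L n R)"

text \<open>Positions are counted from 0, so \<open>set (take i bs)\<close> is the set of the terms strictly before
  the term \<open>bs ! i\<close>.\<close>

definition deduction :: "'a set \<Rightarrow> 'a list set set \<Rightarrow> 'a set \<Rightarrow> 'a list \<Rightarrow> bool" where
  "deduction L RI X bs \<longleftrightarrow> bs \<noteq> [] \<and> bs \<in> lists L \<and>
     (\<forall>i<length bs.
        bs ! i \<in> X \<or>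
        (\<exists>R\<in>RI. nary_rel L 1 R \<and> [bs ! i] \<in> R) \<or>
        (\<exists>j\<ge>1. \<exists>R\<in>RI. nary_rel L (j + 1) R \<and>
           (\<exists>as. length as = j \<and> as @ [bs ! i] \<in> R \<and> set as \<subseteq> set (take i bs))))"

definition deducible :: "'a set \<Rightarrow> 'a list set set \<Rightarrow> 'a set \<Rightarrow> 'a \<Rightarrow> bool" where
  "deducible L RI X x \<longleftrightarrow> (\<exists>bs. deduction L RI X bs \<and> last bs = x)"

text \<open>The relation written \<open>RI(L) \<Rightarrow> C\<close>; the notation presupposes that \<open>RI\<close> is a general
  rules of inference on L, which is made explicit as the first conjunct.\<close>

definition generates :: "'a set \<Rightarrow> 'a list set set \<Rightarrow> ('a set \<Rightarrow> 'a set) \<Rightarrow> bool" where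
  "generates L RI C \<longleftrightarrow>
     rules_of_inference L RI \<and> C = (\<lambda>X\<in>Pow L. {x \<in> L. deducible L RI X x})"

end

theory Submission
  imports Defs
begin

text \<open>Sets of rules enter only through the sets closed under them: the set of all terms deducible
  from X is the least rule-closed set containing X. Hence, if RI generates C, the closed systems of C
  are exactly the sets closed under RI. A set is closed under a union of rules iff it is closed under
  each of them, so the sets closed under the union of all \<open>RI C\<close> are the common closed systems
  of the operators C in H, whose intersections define \<open>sup_w L H\<close>.\<close>

text \<open>A tuple is split as \<open>as @ [a]\<close> with \<open>as\<close> possibly empty, so
  unary relations (axioms) and relations with premises fall under one clause.\<close>

definition rule_closed :: "'a list set set \<Rightarrow> 'a set \<Rightarrow> bool" where
  "rule_closed RI Y \<longleftrightarrow> (\<forall>R\<in>RI. \<forall>as a. as @ [a] \<in> R \<longrightarrow> set as \<subseteq> Y \<longrightarrow> a \<in> Y)"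

lemma rule_closedD:
  "rule_closed RI Y \<Longrightarrow> R \<in> RI \<Longrightarrow> as @ [a] \<in> R \<Longrightarrow> set as \<subseteq> Y \<Longrightarrow> a \<in> Y"
  by (auto simp: rule_closed_def)

lemma rule_closed_UN: "rule_closed (\<Union>i\<in>I. RI i) Y \<longleftrightarrow> (\<forall>i\<in>I. rule_closed (RI i) Y)"
  by (auto simp: rule_closed_def)

section \<open>Rules of inference and deductions\<close>

lemma rules_of_inference_nary_rel:
  assumes "rules_of_inference L RI" "R \<in> RI" "as @ [a] \<in> R"
  shows "nary_rel L (length as + 1) R"
proof -
  obtain n where n: "nary_rel L n R"
    using assms(1,2) unfolding rules_of_inference_def by blast
  \<comment> \<open>One tuple of a relation already determines its arity; only the empty relation
    has several.\<close>
  then have "length (as @ [a]) = n" using assms(3) unfolding nary_rel_def by blast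
  with n show ?thesis by simp
qed

lemma rules_of_inference_in_language:
  assumes "rules_of_inference L RI" "R \<in> RI" "as @ [a] \<in> R"
  shows "a \<in> L"
proof -
  have "as @ [a] \<in> lists L"
    using rules_of_inference_nary_rel[OF assms] assms(3) unfolding nary_rel_def by blast
  then show ?thesis by simp
qed

text \<open>Removes the arity bookkeeping from \<open>deduction\<close>: every relation has the
  arity of its tuples, and the unary clause is the case \<open>as = []\<close> of the general one.
  All later arguments about deductions use this form.\<close>

lemma deduction_iff:
  assumes "rules_of_inference L RI"
  shows "deduction L RI X bs \<longleftrightarrow> bs \<noteq> [] \<and> bs \<in> lists L \<and>
    (\<forall>i<length bs. bs ! i \<in> X \<or>
       (\<exists>R\<in>RI. \<exists>as. as @ [bs ! i] \<in> R \<and> set as \<subseteq> set (take i bs)))"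
proof -
  have "((\<exists>R\<in>RI. nary_rel L 1 R \<and> [b] \<in> R) \<or>
      (\<exists>j\<ge>1. \<exists>R\<in>RI. nary_rel L (j + 1) R \<and> (\<exists>as. length as = j \<and> as @ [b] \<in> R \<and> set as \<subseteq> P)))
    \<longleftrightarrow> (\<exists>R\<in>RI. \<exists>as. as @ [b] \<in> R \<and> set as \<subseteq> P)" (is "?U \<or> ?N \<longleftrightarrow> ?S") for b P
  proof
    assume "?U \<or> ?N"
    then show ?S
      by (metis append_Nil empty_subsetI list.set(1))
  next
    assume ?S
    then obtain R as where R: "R \<in> RI" "as @ [b] \<in> R" "set as \<subseteq> P" by blast
    have nary: "nary_rel L (length as + 1) R"
      using rules_of_inference_nary_rel[OF assms R(1,2)] .
    show "?U \<or> ?N"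
    proof (cases "as = []")
      case True
      with R nary show ?thesis by auto
    next
      case False
      then have "length as \<ge> 1" by (simp add: Suc_le_eq)
      with R nary show ?thesis by blast
    qed
  qed
  then show ?thesis by (simp add: deduction_def)
qed

lemma deduction_append:
  assumes RI: "rules_of_inference L RI"
    and "deduction L RI X bs" "deduction L RI X cs"
  shows "deduction L RI X (bs @ cs)"
proof -
  have "(bs @ cs) ! i \<in> X \<or>
      (\<exists>R\<in>RI. \<exists>as. as @ [(bs @ cs) ! i] \<in> R \<and> set as \<subseteq> set (take i (bs @ cs)))"
    if "i < length (bs @ cs)" for i
  proof (cases "i < length bs")
    case True
    with assms(2) show ?thesis by (simp add: deduction_iff[OF RI] nth_append)
  next
    case False
    with that have "i - length bs < length cs" by auto
    \<comment> \<open>At a position in \<open>cs\<close> the terms before it now include all of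
      \<open>bs\<close>, so the premises found earlier in \<open>cs\<close> are still
      available.\<close>
    with assms(3) False show ?thesis by (fastforce simp: deduction_iff[OF RI] nth_append)
  qed
  with assms show ?thesis by (auto simp: deduction_iff[OF RI])
qed

lemma deduction_snoc:
  assumes RI: "rules_of_inference L RI"
    and bs: "bs = [] \<or> deduction L RI X bs"
    and R: "R \<in> RI" "as @ [a] \<in> R" "set as \<subseteq> set bs"
  shows "deduction L RI X (bs @ [a])"
proof -
  have "(bs @ [a]) ! i \<in> X \<or>
      (\<exists>R\<in>RI. \<exists>as. as @ [(bs @ [a]) ! i] \<in> R \<and> set as \<subseteq> set (take i (bs @ [a])))"
    if "i < length (bs @ [a])" for i
  proof (cases "i < length bs")
    case True
    with bs show ?thesis by (auto simp: deduction_iff[OF RI] nth_append)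
  next
    case False
    with that have "i = length bs" by simp
    with R show ?thesis by auto
  qed
  moreover have "bs @ [a] \<in> lists L"
    using bs rules_of_inference_in_language[OF RI R(1,2)] by (auto simp: deduction_def)
  ultimately show ?thesis by (simp add: deduction_iff[OF RI])
qed

section \<open>Deducible terms as a least rule-closed set\<close>

lemma deducible_in_language: "deducible L RI X x \<Longrightarrow> x \<in> L"
  by (metis deducible_def deduction_def in_listsD last_in_set)

lemma deducible_base:
  assumes "x \<in> X" "X \<subseteq> L"
  shows "deducible L RI X x"
proof -
  have "deduction L RI X [x]" using assms by (auto simp: deduction_def)
  then show ?thesis unfolding deducible_def by (metis last.simps)
qed

text \<open>A rule has finitely many premises, so their deductions can be concatenated into one that
  contains them all; appending the conclusion gives a deduction again.\<close>

lemma rule_closed_deducible: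
  assumes RI: "rules_of_inference L RI"
  shows "rule_closed RI {x. deducible L RI X x}"
  unfolding rule_closed_def
proof (intro ballI allI impI)
  fix R as a
  assume R: "R \<in> RI" "as @ [a] \<in> R" and "set as \<subseteq> {x. deducible L RI X x}"
  from this(3) have "\<exists>bs. (bs = [] \<or> deduction L RI X bs) \<and> set as \<subseteq> set bs"
  proof (induction as)
    case Nil
    then show ?case by auto
  next
    case (Cons x as)
    from Cons obtain bs where bs: "bs = [] \<or> deduction L RI X bs" "set as \<subseteq> set bs" by auto
    from Cons.prems obtain cs where cs: "deduction L RI X cs" "last cs = x"
      by (auto simp: deducible_def)
    then have "x \<in> set cs" by (auto simp: deduction_def)
    moreover have "deduction L RI X (bs @ cs)"
      using bs(1) cs(1) deduction_append[OF RI] by auto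
    ultimately show ?case using bs(2) by (intro exI[of _ "bs @ cs"]) auto
  qed
  then obtain bs where "bs = [] \<or> deduction L RI X bs" "set as \<subseteq> set bs" by blast
  then have "deduction L RI X (bs @ [a])" using deduction_snoc[OF RI _ R] by blast
  then show "a \<in> {x. deducible L RI X x}" unfolding deducible_def by fastforce
qed

text \<open>Strong induction on the position: the premises used at position \<open>i\<close> occur
  earlier and hence already lie in \<open>Y\<close>.\<close>

lemma deduction_subset_rule_closed:
  assumes RI: "rules_of_inference L RI" and ded: "deduction L RI X bs"
    and Y: "X \<subseteq> Y" "rule_closed RI Y"
  shows "set bs \<subseteq> Y"
proof -
  have "bs ! i \<in> Y" if "i < length bs" for i
    using that
  proof (induction i rule: less_induct)
    case (less i)
    have "set (take i bs) \<subseteq> Y"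
      using less by (auto simp: in_set_conv_nth)
    moreover have "bs ! i \<in> X \<or>
        (\<exists>R\<in>RI. \<exists>as. as @ [bs ! i] \<in> R \<and> set as \<subseteq> set (take i bs))"
      using ded less.prems by (simp add: deduction_iff[OF RI])
    ultimately show ?case using Y by (meson rule_closedD subset_trans subsetD)
  qed
  then show ?thesis by (auto simp: in_set_conv_nth)
qed

lemma deducible_eq_Inter_rule_closed:
  assumes RI: "rules_of_inference L RI" and "X \<subseteq> L"
  shows "{x \<in> L. deducible L RI X x} = \<Inter>{Y. X \<subseteq> Y \<and> Y \<subseteq> L \<and> rule_closed RI Y}"
proof
  show "{x \<in> L. deducible L RI X x} \<subseteq> \<Inter>{Y. X \<subseteq> Y \<and> Y \<subseteq> L \<and> rule_closed RI Y}"
  proof (intro subsetI InterI)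
    fix x Y
    assume "x \<in> {x \<in> L. deducible L RI X x}" "Y \<in> {Y. X \<subseteq> Y \<and> Y \<subseteq> L \<and> rule_closed RI Y}"
    then obtain bs where bs: "deduction L RI X bs" "last bs = x" and "X \<subseteq> Y" "rule_closed RI Y"
      by (auto simp: deducible_def)
    then have "set bs \<subseteq> Y" using deduction_subset_rule_closed[OF RI] by blast
    moreover from bs have "x \<in> set bs" by (auto simp: deduction_def)
    ultimately show "x \<in> Y" by blast
  qed
  have "{x \<in> L. deducible L RI X x} = {x. deducible L RI X x}"
    by (auto dest: deducible_in_language)
  \<comment> \<open>The set of deducible terms is itself a member of the intersected family.\<close>
  then show "\<Inter>{Y. X \<subseteq> Y \<and> Y \<subseteq> L \<and> rule_closed RI Y} \<subseteq> {x \<in> L. deducible L RI X x}"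
    using rule_closed_deducible[OF RI] deducible_base \<open>X \<subseteq> L\<close>
    by (intro Inter_lower) auto
qed

text \<open>\<open>C Y\<close> is the least rule-closed set between \<open>Y\<close> and
  \<open>L\<close>, so it equals \<open>Y\<close> exactly when \<open>Y\<close> is
  rule-closed.\<close>

lemma closed_systems_generates:
  assumes "generates L RI C"
  shows "closed_systems L C = {Y. Y \<subseteq> L \<and> rule_closed RI Y}"
proof -
  have RI: "rules_of_inference L RI" and C: "C = (\<lambda>X\<in>Pow L. {x \<in> L. deducible L RI X x})"
    using assms by (simp_all add: generates_def)
  have "C Y = Y \<longleftrightarrow> rule_closed RI Y" if "Y \<subseteq> L" for Y
  proof -
    have CY: "C Y = {x \<in> L. deducible L RI Y x}" using that by (simp add: C)
    then have CY': "C Y = {x. deducible L RI Y x}" by (auto dest: deducible_in_language)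
    show ?thesis
    proof
      assume "C Y = Y"
      then show "rule_closed RI Y" using rule_closed_deducible[OF RI, of Y] CY' by simp
    next
      assume "rule_closed RI Y"
      then show "C Y = Y"
        unfolding CY deducible_eq_Inter_rule_closed[OF RI that] using that by blast
    qed
  qed
  then show ?thesis by (auto simp: closed_systems_def)
qed

lemma rules_of_inference_UN:
  "rules_of_inference L (\<Union>i\<in>I. RI i) \<longleftrightarrow> (\<forall>i\<in>I. rules_of_inference L (RI i))"
  by (auto simp: rules_of_inference_def)

text \<open>Both operators are intersections over supersets of \<open>X\<close> in \<open>L\<close>,
  and the two families agree: being closed for every \<open>C\<close> in \<open>H\<close> means
  being closed under every \<open>RI C\<close>, hence under their union.\<close>

lemma generates_sup_w:
  assumes "\<And>C. C \<in> H \<Longrightarrow> generates L (RI C) C"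
  shows "generates L (\<Union>C\<in>H. RI C) (sup_w L H)"
proof -
  have RI: "rules_of_inference L (\<Union>C\<in>H. RI C)"
    using assms by (simp add: rules_of_inference_UN generates_def)
  have "Y \<in> (\<Inter>C\<in>H. closed_systems L C) \<longleftrightarrow> rule_closed (\<Union>C\<in>H. RI C) Y" if "Y \<subseteq> L" for Y
  proof -
    have "Y \<in> closed_systems L C \<longleftrightarrow> rule_closed (RI C) Y" if "C \<in> H" for C
      using closed_systems_generates[OF assms[OF that]] \<open>Y \<subseteq> L\<close> by simp
    then show ?thesis by (simp add: rule_closed_UN)
  qed
  then have "{Y. X \<subseteq> Y \<and> Y \<subseteq> L \<and> Y \<in> (\<Inter>C\<in>H. closed_systems L C)} =
      {Y. X \<subseteq> Y \<and> Y \<subseteq> L \<and> rule_closed (\<Union>C\<in>H. RI C) Y}" for X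
    by blast
  then have "sup_w L H = (\<lambda>X\<in>Pow L. {x \<in> L. deducible L (\<Union>C\<in>H. RI C) X x})"
    unfolding sup_w_def by (intro restrict_ext) (simp only: deducible_eq_Inter_rule_closed[OF RI] Pow_iff)
  with RI show ?thesis by (simp add: generates_def)
qed

section \<open>The supremum in the order of consequence operators\<close>

lemma conseq_ops_mono:
  "C \<in> conseq_ops L \<Longrightarrow> X \<subseteq> Y \<Longrightarrow> Y \<subseteq> L \<Longrightarrow> C X \<subseteq> C Y"
  by (simp add: conseq_ops_def)

lemma conseq_ops_extensive: "C \<in> conseq_ops L \<Longrightarrow> X \<subseteq> L \<Longrightarrow> X \<subseteq> C X"
  by (simp add: conseq_ops_def)

lemma conseq_ops_idem: "C \<in> conseq_ops L \<Longrightarrow> X \<subseteq> L \<Longrightarrow> C (C X) = C X"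
  by (simp add: conseq_ops_def)

lemma conseq_ops_subset: "C \<in> conseq_ops L \<Longrightarrow> X \<subseteq> L \<Longrightarrow> C X \<subseteq> L"
  by (auto simp: conseq_ops_def)

lemma sup_w_subset_closed:
  assumes "X \<subseteq> Y" "Y \<subseteq> L" "\<forall>C\<in>H. C Y = Y"
  shows "sup_w L H X \<subseteq> Y"
  using assms by (auto simp: sup_w_def closed_systems_def)

lemma subset_sup_w:
  assumes "X \<subseteq> L" "\<And>Y. X \<subseteq> Y \<Longrightarrow> Y \<subseteq> L \<Longrightarrow> (\<forall>C\<in>H. C Y = Y) \<Longrightarrow> Z \<subseteq> Y"
  shows "Z \<subseteq> sup_w L H X"
proof -
  have "Z \<subseteq> \<Inter>{Y. X \<subseteq> Y \<and> Y \<subseteq> L \<and> Y \<in> (\<Inter>C\<in>H. closed_systems L C)}"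
    by (intro Inter_greatest assms(2)) (auto simp: closed_systems_def)
  then show ?thesis using assms(1) by (simp add: sup_w_def)
qed

lemma sup_w_subset:
  assumes "H \<subseteq> conseq_ops L" "X \<subseteq> L"
  shows "sup_w L H X \<subseteq> L"
proof (rule sup_w_subset_closed)
  show "\<forall>C\<in>H. C L = L"
  proof
    fix C assume "C \<in> H"
    with assms(1) have "C \<in> conseq_ops L" by blast
    then show "C L = L" using conseq_ops_extensive[of C L L] conseq_ops_subset[of C L L] by blast
  qed
qed (use assms in auto)

lemma sup_w_in_conseq_ops:
  assumes H: "H \<subseteq> conseq_ops L"
  shows "sup_w L H \<in> conseq_ops L"
proof -
  note sub = sup_w_subset[OF H]
  have ext: "X \<subseteq> sup_w L H X" if "X \<subseteq> L" for X
    using that by (rule subset_sup_w)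
  \<comment> \<open>A common closed set above \<open>X\<close> also contains
    \<open>sup_w L H X\<close>, so it is one of the sets intersected for
    \<open>sup_w L H (sup_w L H X)\<close>.\<close>
  have "sup_w L H (sup_w L H X) \<subseteq> sup_w L H X" if "X \<subseteq> L" for X
    using that by (rule subset_sup_w) (intro sup_w_subset_closed)
  with ext sub have "sup_w L H X = sup_w L H (sup_w L H X)" if "X \<subseteq> L" for X
    using that by (meson subset_antisym)
  moreover have "sup_w L H X \<subseteq> sup_w L H Y" if "X \<subseteq> Y" "Y \<subseteq> L" for X Y
    using that(2)
    by (rule subset_sup_w) (intro sup_w_subset_closed subset_trans[OF that(1)])
  moreover have "sup_w L H \<in> Pow L \<rightarrow>\<^sub>E Pow L"
    using sub by (intro PiE_I) (auto simp: sup_w_def)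
  ultimately show ?thesis using ext by (simp add: conseq_ops_def)
qed

text \<open>\<open>Upper\<close> only tests the elements of \<open>H\<close> that lie in the
  carrier; here these are all of \<open>H\<close>.\<close>

lemma Upper_conseq_order:
  assumes "H \<subseteq> conseq_ops L"
  shows "D \<in> Upper (conseq_order L) H \<longleftrightarrow> D \<in> conseq_ops L \<and> (\<forall>C\<in>H. \<forall>X\<in>Pow L. C X \<subseteq> D X)"
proof -
  have "H \<inter> conseq_ops L = H" using assms by blast
  then show ?thesis by (auto simp: Upper_def conseq_order_def simp flip: Int_iff)
qed

lemma is_lub_sup_w:
  assumes H: "H \<subseteq> conseq_ops L"
  shows "is_lub (conseq_order L) (sup_w L H) H"
  unfolding least_def
proof (intro conjI ballI)
  show "Upper (conseq_order L) H \<subseteq> carrier (conseq_order L)" by simp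
  have "C X \<subseteq> sup_w L H X" if "C \<in> H" "X \<subseteq> L" for C X
    using that(2)
  proof (rule subset_sup_w)
    fix Y assume "X \<subseteq> Y" "Y \<subseteq> L" "\<forall>C\<in>H. C Y = Y"
    moreover have "C \<in> conseq_ops L" using that H by blast
    \<comment> \<open>By monotonicity, \<open>C X\<close> is contained in \<open>C Y\<close>, which
      is \<open>Y\<close>.\<close>
    ultimately show "C X \<subseteq> Y" using conseq_ops_mono[of C L X Y] that by metis
  qed
  then show "sup_w L H \<in> Upper (conseq_order L) H"
    using sup_w_in_conseq_ops[OF H] by (simp add: Upper_conseq_order[OF H])
next
  fix D assume "D \<in> Upper (conseq_order L) H"
  then have D: "D \<in> conseq_ops L" and le: "\<And>C X. C \<in> H \<Longrightarrow> X \<subseteq> L \<Longrightarrow> C X \<subseteq> D X"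
    by (simp_all add: Upper_conseq_order[OF H])
  \<comment> \<open>\<open>D X\<close> is a common closed set above \<open>X\<close>: for
    \<open>C\<close> in \<open>H\<close>, \<open>C (D X)\<close> is contained in
    \<open>D (D X) = D X\<close>.\<close>
  have "sup_w L H X \<subseteq> D X" if X: "X \<subseteq> L" for X
  proof (rule sup_w_subset_closed)
    show "X \<subseteq> D X" using conseq_ops_extensive[OF D X] .
    show DX: "D X \<subseteq> L" using conseq_ops_subset[OF D X] .
    show "\<forall>C\<in>H. C (D X) = D X"
    proof
      fix C assume C: "C \<in> H"
      then have "C (D X) \<subseteq> D X" using le[OF C DX] conseq_ops_idem[OF D X] by simp
      then show "C (D X) = D X" using C H DX conseq_ops_extensive[of C L "D X"] by blast
    qed
  qed
  then show "sup_w L H \<sqsubseteq>\<^bsub>conseq_order L\<^esub> D" by (simp add: conseq_order_def)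
qed

theorem theorem2p2:
  fixes L :: "'a set"
    and H :: "('a set \<Rightarrow> 'a set) set"
    and RI :: "('a set \<Rightarrow> 'a set) \<Rightarrow> 'a list set set"
  assumes "L \<noteq> {}"
    and "H \<noteq> {}"
    and "H \<subseteq> finite_conseq_ops L"
    and "\<And>C. C \<in> H \<Longrightarrow> generates L (RI C) C"
  shows "generates L (\<Union>C\<in>H. RI C) (sup_w L H) \<and>
         is_lub (conseq_order L) (sup_w L H) H"
  using assms(3) generates_sup_w[OF assms(4)] is_lub_sup_w[of H L]
  by (auto simp: finite_conseq_ops_def)

end
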